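(* Let $I\subseteq\mathbb{R}$ be an interval and let $f,g\in C^\infty(I)$ be smooth real-valued functions on $I$. Suppose that $f$ and $g$ have only simple zeros in $I$ and that their zero sets are identical, i.e. $\{a\in I : f(a)=0\}=\{a\in I : g(a)=0\}$. Then there exists a non-vanishing smooth real-valued function $\varphi\in C^\infty(I)$ such that $f=g\varphi$ on $I$ and $\varphi(a)=f'(a)/g'(a)$ at every common zero $a$ of $f$ and $g$.
   Context: A real function $f$ on an interval $I$ is said to have simple zeros if $f'(a)\neq 0$ whenever $a\in I$ and $f(a)=0$. Non-vanishing means nonzero at every point of the domain. *)

theory Defs
  imports "HOL-Analysis.Analysis"
begin

text \<open>
  A function on \<open>I\<close> is a total function of which only the values on \<open>I\<close> matter: for \<open>x \<in> I\<close>, the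
  number below depends only on the restriction of \<open>f\<close> to \<open>I\<close>, and it is the one-sided derivative
  at an endpoint that belongs to \<open>I\<close>. It is unique as soon as \<open>I\<close> has at least two points
  (\<open>deriv_within_eq\<close>).
\<close>

definition deriv_within :: "real set \<Rightarrow> (real \<Rightarrow> real) \<Rightarrow> real \<Rightarrow> real"
  where "deriv_within I f x = vector_derivative f (at x within I)"

definition smooth_on :: "real set \<Rightarrow> (real \<Rightarrow> real) \<Rightarrow> bool"
  where "smooth_on I f \<longleftrightarrow> (\<forall>n::nat. (deriv_within I ^^ n) f differentiable_on I)"

definition simple_zeros_on :: "real set \<Rightarrow> (real \<Rightarrow> real) \<Rightarrow> bool"
  where "simple_zeros_on I f \<longleftrightarrow> (\<forall>a\<in>I. f a = 0 \<longrightarrow> deriv_within I f a \<noteq> 0)"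

lemma deriv_within_eq:
  assumes "is_interval I" "x \<in> I" "y \<in> I" "x \<noteq> y"
    and "(f has_real_derivative D) (at x within I)"
  shows "deriv_within I f x = D"
proof -
  have "connected I" using assms(1) by (simp add: is_interval_connected)
  then have "x islimpt I"
    using assms(2-4) connected_imp_perfect[of I x] by auto
  then have "at x within I \<noteq> bot"
    by (simp add: trivial_limit_within)
  then show ?thesis
    using assms(5) unfolding deriv_within_def
    by (intro vector_derivative_within)
      (simp_all add: has_real_derivative_iff_has_vector_derivative)
qed

end

theory Submission
  imports Defs
begin

text \<open>
  The only candidate for \<open>\<phi>\<close> is \<open>f / g\<close> off the common zeros and \<open>f' / g'\<close> at them. It does not vanish,
  as \<open>f\<close> and \<open>g\<close> have the same zeros and these are simple; what has to be proved is that it is smooth.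

  At a common zero \<open>a\<close> both functions are divisible by \<open>x - a\<close> (Hadamard's lemma,
  \<open>smooth_on_linear_factor\<close>): \<open>f x = (x - a) F x\<close> and \<open>g x = (x - a) G x\<close> with \<open>F\<close>, \<open>G\<close> smooth,
  \<open>F a = f' a\<close> and \<open>G a = g' a \<noteq> 0\<close>. Wherever \<open>G\<close> does not vanish, in particular near \<open>a\<close>, the factor
  \<open>x - a\<close> cancels and \<open>\<phi> = F / G\<close>, at \<open>a\<close> itself because of the values of \<open>F\<close> and \<open>G\<close> there. At the
  other points \<open>F = f\<close> and \<open>G = g\<close> serve. So \<open>\<phi>\<close> is locally a quotient of smooth functions with
  nonzero denominator, and smoothness is a local property (\<open>smooth_on_local_quotient\<close>).

  Endpoints of \<open>I\<close> need no separate treatment, since all derivatives are taken within \<open>I\<close>; they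
  are unique because every point of \<open>I\<close> is a limit point of \<open>I\<close>. An interval fails this only if it is
  a single point, and there every function is smooth.
\<close>

section \<open>Locality of iterated derivatives\<close>

lemma has_real_derivative_within_Int_open:
  fixes f g :: "real \<Rightarrow> real"
  assumes "open U" "x \<in> I \<inter> U" and eq: "\<And>y. y \<in> I \<inter> U \<Longrightarrow> f y = g y"
  shows "(f has_real_derivative D) (at x within I) \<longleftrightarrow>
         (g has_real_derivative D) (at x within (I \<inter> U))"
proof -
  have "at x within I = at x within (I \<inter> U)"
    by (rule at_within_nhd[of x U]) (use assms in auto)
  moreover have "eventually (\<lambda>y. f y = g y) (at x within (I \<inter> U))"
    by (simp add: eventually_at_filter eq)
  ultimately show ?thesis
    using has_field_derivative_cong_eventually[of f g x "I \<inter> U"] assms by simp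
qed

lemma deriv_within_Int_open:
  assumes "open U" "x \<in> I \<inter> U" "\<And>y. y \<in> I \<inter> U \<Longrightarrow> f y = g y"
  shows "deriv_within I f x = deriv_within (I \<inter> U) g x"
  using has_real_derivative_within_Int_open[OF assms]
  by (simp add: deriv_within_def vector_derivative_def has_real_derivative_iff_has_vector_derivative)

text \<open>
  Agreement on the whole relatively open set, not just at \<open>x\<close>, is what passes from one derivative to
  the next.
\<close>

lemma deriv_within_funpow_Int_open:
  assumes "open U" "\<And>y. y \<in> I \<inter> U \<Longrightarrow> f y = g y" "x \<in> I \<inter> U"
  shows "(deriv_within I ^^ n) f x = (deriv_within (I \<inter> U) ^^ n) g x"
  using assms(3)
proof (induction n arbitrary: x)
  case 0
  then show ?case using assms by simp
next
  case (Suc n)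
  then show ?case
    using deriv_within_Int_open[OF assms(1) Suc.prems Suc.IH] by simp
qed

lemma funpow_differentiable_Int_open:
  assumes "open U" "\<And>y. y \<in> I \<inter> U \<Longrightarrow> f y = g y" "x \<in> I \<inter> U"
  shows "(deriv_within I ^^ n) f differentiable (at x within I) \<longleftrightarrow>
         (deriv_within (I \<inter> U) ^^ n) g differentiable (at x within (I \<inter> U))"
proof -
  have "((deriv_within I ^^ n) f has_real_derivative D) (at x within I) \<longleftrightarrow>
      ((deriv_within (I \<inter> U) ^^ n) g has_real_derivative D) (at x within (I \<inter> U))" for D
    by (rule has_real_derivative_within_Int_open[OF assms(1,3)])
      (rule deriv_within_funpow_Int_open[OF assms(1,2)])
  then show ?thesis unfolding real_differentiable_def by (simp only:)
qed

lemma smooth_on_Int_open: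
  assumes "smooth_on I f" "open U"
  shows "smooth_on (I \<inter> U) f"
  unfolding smooth_on_def differentiable_on_def
proof (intro allI ballI)
  fix n x assume x: "x \<in> I \<inter> U"
  then have "(deriv_within I ^^ n) f differentiable (at x within I)"
    using assms(1) by (simp add: smooth_on_def differentiable_on_def)
  then show "(deriv_within (I \<inter> U) ^^ n) f differentiable (at x within (I \<inter> U))"
    by (rule funpow_differentiable_Int_open[OF assms(2) refl x, THEN iffD1])
qed

lemma smooth_on_locally:
  assumes "\<And>x. x \<in> I \<Longrightarrow>
    \<exists>U h. open U \<and> x \<in> U \<and> smooth_on (I \<inter> U) h \<and> (\<forall>y\<in>I \<inter> U. f y = h y)"
  shows "smooth_on I f"
  unfolding smooth_on_def differentiable_on_def
proof (intro allI ballI)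
  fix n x assume x: "x \<in> I"
  from assms[OF x] obtain U h where *: "open U" "x \<in> U" "smooth_on (I \<inter> U) h"
      "\<forall>y\<in>I \<inter> U. f y = h y"
    by (elim exE conjE)
  then have U: "open U" "x \<in> I \<inter> U"
    and h: "smooth_on (I \<inter> U) h" "\<And>y. y \<in> I \<inter> U \<Longrightarrow> f y = h y"
    using x by simp_all
  from h(1) U(2) have "(deriv_within (I \<inter> U) ^^ n) h differentiable (at x within (I \<inter> U))"
    by (simp add: smooth_on_def differentiable_on_def)
  then show "(deriv_within I ^^ n) f differentiable (at x within I)"
    using funpow_differentiable_Int_open[of U I f h x n] U h(2) by blast
qed

section \<open>Finite order of differentiability\<close>

text \<open>
  Closure of smoothness under algebraic operations and under integration is shown by induction on the
  order. The order counts differentiations, so that order \<open>0\<close> is no condition at all and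
  \<open>f\<close> has order \<open>n + 1\<close> iff it is differentiable and \<open>f'\<close> has order \<open>n\<close>.
\<close>

definition differentiable_times_on :: "nat \<Rightarrow> real set \<Rightarrow> (real \<Rightarrow> real) \<Rightarrow> bool"
  where "differentiable_times_on n I f \<longleftrightarrow>
    (\<forall>k<n. (deriv_within I ^^ k) f differentiable_on I)"

lemma smooth_on_iff_differentiable_times:
  "smooth_on I f \<longleftrightarrow> (\<forall>n. differentiable_times_on n I f)"
  by (auto simp: smooth_on_def differentiable_times_on_def)

lemma differentiable_times_0 [simp]: "differentiable_times_on 0 I f"
  by (simp add: differentiable_times_on_def)

lemma differentiable_times_Suc:
  "differentiable_times_on (Suc n) I f \<longleftrightarrow>
     f differentiable_on I \<and> differentiable_times_on n I (deriv_within I f)"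
  by (auto simp: differentiable_times_on_def less_Suc_eq_0_disj funpow_swap1)

lemma differentiable_times_SucD:
  assumes "differentiable_times_on (Suc n) I f"
  shows "differentiable_times_on n I f"
  using assms by (auto simp: differentiable_times_on_def)

lemma differentiable_times_cong:
  assumes "differentiable_times_on n I f" "\<And>x. x \<in> I \<Longrightarrow> f x = g x"
  shows "differentiable_times_on n I g"
  unfolding differentiable_times_on_def differentiable_on_def
proof (intro allI impI ballI)
  fix k x assume "k < n" and x: "x \<in> I"
  then have "(deriv_within I ^^ k) f differentiable (at x within I)"
    using assms(1) by (simp add: differentiable_times_on_def differentiable_on_def)
  then show "(deriv_within I ^^ k) g differentiable (at x within I)"
    using funpow_differentiable_Int_open[of UNIV I f g x k] assms(2) x by simp
qed

lemma differentiable_on_has_deriv_within: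
  assumes "f differentiable_on I" "x \<in> I"
  shows "(f has_real_derivative deriv_within I f x) (at x within I)"
  using assms unfolding differentiable_on_def deriv_within_def
  by (simp add: has_real_derivative_iff_has_vector_derivative vector_derivative_works)

text \<open>
  Any function \<open>h\<close> that is a derivative of \<open>f\<close> on \<open>I\<close> may be used to count differentiations; that \<open>I\<close>
  has no isolated points makes \<open>h\<close> agree with \<open>deriv_within I f\<close> on \<open>I\<close>.
\<close>

lemma differentiable_times_SucI:
  assumes lim: "\<And>x. x \<in> I \<Longrightarrow> x islimpt I"
    and D: "\<And>x. x \<in> I \<Longrightarrow> (f has_real_derivative h x) (at x within I)"
    and h: "differentiable_times_on n I h"
  shows "differentiable_times_on (Suc n) I f"
proof -
  have "h x = deriv_within I f x" if "x \<in> I" for x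
    unfolding deriv_within_def
    by (rule vector_derivative_within[symmetric])
      (use lim[OF that] D[OF that] in
        \<open>auto simp: trivial_limit_within has_real_derivative_iff_has_vector_derivative\<close>)
  then have "differentiable_times_on n I (deriv_within I f)"
    by (rule differentiable_times_cong[OF h])
  moreover have "f differentiable_on I"
    using D by (auto simp: differentiable_on_def real_differentiable_def)
  ultimately show ?thesis by (simp add: differentiable_times_Suc)
qed

lemma differentiable_times_uminus:
  assumes lim: "\<And>x. x \<in> I \<Longrightarrow> x islimpt I" and "differentiable_times_on n I f"
  shows "differentiable_times_on n I (\<lambda>x. - f x)"
  using assms(2)
proof (induction n arbitrary: f)
  case (Suc n)
  then have f: "f differentiable_on I" "differentiable_times_on n I (deriv_within I f)"
    by (auto simp: differentiable_times_Suc)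
  show ?case
    by (rule differentiable_times_SucI[OF lim DERIV_minus[OF differentiable_on_has_deriv_within[OF f(1)]]
          Suc.IH[OF f(2)]])
qed simp

lemma differentiable_times_add:
  assumes lim: "\<And>x. x \<in> I \<Longrightarrow> x islimpt I"
    and "differentiable_times_on n I f" "differentiable_times_on n I g"
  shows "differentiable_times_on n I (\<lambda>x. f x + g x)"
  using assms(2,3)
proof (induction n arbitrary: f g)
  case (Suc n)
  then have f: "f differentiable_on I" "differentiable_times_on n I (deriv_within I f)"
    and g: "g differentiable_on I" "differentiable_times_on n I (deriv_within I g)"
    by (auto simp: differentiable_times_Suc)
  show ?case
    by (rule differentiable_times_SucI[OF lim DERIV_add[OF differentiable_on_has_deriv_within[OF f(1)]
            differentiable_on_has_deriv_within[OF g(1)]] Suc.IH[OF f(2) g(2)]])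
qed simp

lemma differentiable_times_mult:
  assumes lim: "\<And>x. x \<in> I \<Longrightarrow> x islimpt I"
    and "differentiable_times_on n I f" "differentiable_times_on n I g"
  shows "differentiable_times_on n I (\<lambda>x. f x * g x)"
  using assms(2,3)
proof (induction n arbitrary: f g)
  case (Suc n)
  then have f: "f differentiable_on I" "differentiable_times_on n I (deriv_within I f)"
    and g: "g differentiable_on I" "differentiable_times_on n I (deriv_within I g)"
    by (auto simp: differentiable_times_Suc)
  show ?case
  proof (rule differentiable_times_SucI[OF lim])
    show "((\<lambda>x. f x * g x) has_real_derivative deriv_within I f x * g x + deriv_within I g x * f x)
        (at x within I)" if "x \<in> I" for x
      by (intro DERIV_mult differentiable_on_has_deriv_within f(1) g(1) that)
    show "differentiable_times_on n I (\<lambda>x. deriv_within I f x * g x + deriv_within I g x * f x)"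
      by (intro differentiable_times_add lim Suc.IH f(2) g(2) Suc.prems[THEN differentiable_times_SucD])
  qed
qed simp

text \<open>
  In \<open>(1/f)' = - f' (1/f)\<^sup>2\<close> the right-hand side contains \<open>1/f\<close> undifferentiated, so that the induction
  hypothesis applies to it and no formula for the higher derivatives is needed.
\<close>

lemma differentiable_times_inverse:
  assumes lim: "\<And>x. x \<in> I \<Longrightarrow> x islimpt I"
    and nz: "\<And>x. x \<in> I \<Longrightarrow> f x \<noteq> 0" and "differentiable_times_on n I f"
  shows "differentiable_times_on n I (\<lambda>x. inverse (f x))"
  using assms(3)
proof (induction n)
  case (Suc n)
  then have f: "f differentiable_on I" "differentiable_times_on n I (deriv_within I f)"
    by (auto simp: differentiable_times_Suc)
  show ?case
  proof (rule differentiable_times_SucI[OF lim])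
    show "((\<lambda>x. inverse (f x)) has_real_derivative
        - (inverse (f x) * deriv_within I f x * inverse (f x))) (at x within I)" if "x \<in> I" for x
      by (intro DERIV_inverse' differentiable_on_has_deriv_within f(1) nz that)
    show "differentiable_times_on n I (\<lambda>x. - (inverse (f x) * deriv_within I f x * inverse (f x)))"
      by (intro differentiable_times_uminus differentiable_times_mult lim Suc.IH f(2)
          Suc.prems[THEN differentiable_times_SucD])
  qed
qed simp

lemma smooth_on_divide:
  assumes "\<And>x. x \<in> I \<Longrightarrow> x islimpt I" "smooth_on I f" "smooth_on I g" "\<And>x. x \<in> I \<Longrightarrow> g x \<noteq> 0"
  shows "smooth_on I (\<lambda>x. f x / g x)"
  using assms unfolding smooth_on_iff_differentiable_times divide_inverse
  by (intro allI differentiable_times_mult differentiable_times_inverse) auto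

lemma smooth_on_deriv_within:
  assumes "smooth_on I f"
  shows "smooth_on I (deriv_within I f)"
  unfolding smooth_on_iff_differentiable_times
proof
  fix n
  have "differentiable_times_on (Suc n) I f"
    using assms by (simp add: smooth_on_iff_differentiable_times)
  then show "differentiable_times_on n I (deriv_within I f)"
    by (simp add: differentiable_times_Suc)
qed

lemma smooth_on_imp_differentiable_on: "smooth_on I f \<Longrightarrow> f differentiable_on I"
  unfolding smooth_on_def by (drule spec[of _ 0]) simp

lemma smooth_on_imp_continuous_on: "smooth_on I f \<Longrightarrow> continuous_on I f"
  by (intro differentiable_imp_continuous_on smooth_on_imp_differentiable_on)

section \<open>Division by a linear factor\<close>

lemma segment_in_convex:
  fixes I :: "real set"
  assumes "convex I" "a \<in> I" "x \<in> I" "t \<in> {0..1}"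
  shows "a + t * (x - a) \<in> I"
proof -
  have "(1 - t) *\<^sub>R a + t *\<^sub>R x \<in> I"
    using assms by (intro convexD) auto
  then show ?thesis by (simp add: algebra_simps)
qed

text \<open>
  Both variables of \<open>f (a + t (x - a))\<close> matter: \<open>x\<close> for differentiating under the integral sign, \<open>t\<close> for
  the fundamental theorem of calculus.
\<close>

lemma has_real_derivative_segment:
  assumes "convex I" "a \<in> I" "f differentiable_on I" "x \<in> I" "t \<in> {0..1}"
  shows "((\<lambda>x. f (a + t * (x - a))) has_real_derivative deriv_within I f (a + t * (x - a)) * t)
           (at x within I)"
    and "((\<lambda>t. f (a + t * (x - a))) has_real_derivative deriv_within I f (a + t * (x - a)) * (x - a))
           (at t within {0..1})"
proof -
  have D: "(f has_real_derivative deriv_within I f (a + t * (x - a))) (at (a + t * (x - a)) within I)"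
    by (intro differentiable_on_has_deriv_within segment_in_convex assms)
  have "(\<lambda>x. a + t * (x - a)) ` I \<subseteq> I"
    using segment_in_convex assms by blast
  moreover have "((\<lambda>x. a + t * (x - a)) has_real_derivative t) (at x within I)"
    by (auto intro!: derivative_eq_intros)
  ultimately show "((\<lambda>x. f (a + t * (x - a))) has_real_derivative
      deriv_within I f (a + t * (x - a)) * t) (at x within I)"
    using DERIV_image_chain[of f _ "\<lambda>x. a + t * (x - a)" x I t] has_field_derivative_subset[OF D]
    by (simp add: o_def)
  have "(\<lambda>t. a + t * (x - a)) ` {0..1} \<subseteq> I"
    using segment_in_convex assms by blast
  moreover have "((\<lambda>t. a + t * (x - a)) has_real_derivative (x - a)) (at t within {0..1})"
    by (auto intro!: derivative_eq_intros)
  ultimately show "((\<lambda>t. f (a + t * (x - a))) has_real_derivative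
      deriv_within I f (a + t * (x - a)) * (x - a)) (at t within {0..1})"
    using DERIV_image_chain[of f _ "\<lambda>t. a + t * (x - a)" t "{0..1}" "x - a"]
      has_field_derivative_subset[OF D]
    by (simp add: o_def)
qed

text \<open>
  Differentiating under the integral sign replaces \<open>h\<close> by \<open>h'\<close> and brings out one factor \<open>t\<close>; with a
  general weight \<open>t ^ k\<close> the statement therefore reproduces itself, and induction on the order works.
\<close>

lemma differentiable_times_segment_integral:
  assumes lim: "\<And>x. x \<in> I \<Longrightarrow> x islimpt I" and I: "convex I" "a \<in> I" and "smooth_on I h"
  shows "differentiable_times_on n I (\<lambda>x. integral {0..1} (\<lambda>t. t ^ k * h (a + t * (x - a))))"
  using assms(4)
proof (induction n arbitrary: k h)
  case (Suc n)
  let ?h' = "deriv_within I h"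
  have h': "smooth_on I ?h'" using Suc.prems by (rule smooth_on_deriv_within)
  have h: "h differentiable_on I" using Suc.prems by (rule smooth_on_imp_differentiable_on)
  have cont: "continuous_on (I \<times> {0..1}) (\<lambda>(x, t). t ^ m * u (a + t * (x - a)))"
    if "smooth_on I u" for m u
    unfolding case_prod_unfold
    by (intro continuous_intros continuous_on_compose2[OF smooth_on_imp_continuous_on[OF that]])
      (auto intro!: segment_in_convex I)
  show ?case
  proof (rule differentiable_times_SucI[OF lim])
    fix x assume x: "x \<in> I"
    show "((\<lambda>x. integral {0..1} (\<lambda>t. t ^ k * h (a + t * (x - a)))) has_real_derivative
        integral {0..1} (\<lambda>t. t ^ Suc k * ?h' (a + t * (x - a)))) (at x within I)"
      unfolding box_real(2)[symmetric]
    proof (rule leibniz_rule_field_derivative[OF _ _ _ x I(1)])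
      fix y t :: real assume yt: "y \<in> I" "t \<in> cbox 0 1"
      show "((\<lambda>x. t ^ k * h (a + t * (x - a))) has_real_derivative
          t ^ Suc k * ?h' (a + t * (y - a))) (at y within I)"
        using DERIV_cmult[OF has_real_derivative_segment(1)[OF I h, of y t], of "t ^ k"] yt
        by (simp add: mult_ac)
    next
      fix y assume y: "y \<in> I"
      have "continuous_on {0..1} (\<lambda>t. t ^ k * h (a + t * (y - a)))"
        by (intro continuous_intros
            continuous_on_compose2[OF smooth_on_imp_continuous_on[OF Suc.prems]])
          (auto intro!: segment_in_convex I y)
      then show "(\<lambda>t. t ^ k * h (a + t * (y - a))) integrable_on cbox 0 1"
        by (simp add: integrable_continuous_real)
    next
      show "continuous_on (I \<times> cbox 0 1) (\<lambda>(x, t). t ^ Suc k * ?h' (a + t * (x - a)))"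
        using cont[OF h', of "Suc k"] by simp
    qed
  next
    show "differentiable_times_on n I
        (\<lambda>x. integral {0..1} (\<lambda>t. t ^ Suc k * ?h' (a + t * (x - a))))"
      using h' by (rule Suc.IH)
  qed
qed simp

text \<open>
  The cofactor is \<open>F x = (\<integral>\<^sub>0\<^sup>1 f' (a + t (x - a)) dt)\<close>: the integrand times \<open>x - a\<close> is the derivative in
  \<open>t\<close> of \<open>f (a + t (x - a))\<close>. Unlike the difference quotient, this formula treats \<open>x = a\<close> as any other
  point.
\<close>

lemma smooth_on_linear_factor:
  assumes lim: "\<And>x. x \<in> I \<Longrightarrow> x islimpt I" and I: "convex I" "a \<in> I" and f: "smooth_on I f"
  obtains F where "smooth_on I F" "F a = deriv_within I f a"
    "\<And>x. x \<in> I \<Longrightarrow> f x = f a + (x - a) * F x"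
proof
  let ?F = "\<lambda>x. integral {0..1} (\<lambda>t. deriv_within I f (a + t * (x - a)))"
  have f': "smooth_on I (deriv_within I f)" using f by (rule smooth_on_deriv_within)
  show "smooth_on I ?F"
    using differentiable_times_segment_integral[OF lim I f', of _ 0]
    by (simp add: smooth_on_iff_differentiable_times)
  show "?F a = deriv_within I f a" by simp
  fix x assume x: "x \<in> I"
  have "((\<lambda>t. deriv_within I f (a + t * (x - a)) * (x - a)) has_integral
      f (a + 1 * (x - a)) - f (a + 0 * (x - a))) {0..1}"
    by (rule fundamental_theorem_of_calculus)
      (use has_real_derivative_segment(2)[OF I smooth_on_imp_differentiable_on[OF f] x] in
        \<open>auto simp: has_real_derivative_iff_has_vector_derivative\<close>)
  then have "integral {0..1} (\<lambda>t. deriv_within I f (a + t * (x - a)) * (x - a)) = f x - f a"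
    by (auto dest: integral_unique)
  then show "f x = f a + (x - a) * ?F x" by (simp add: mult.commute)
qed

section \<open>Quotients of smooth functions\<close>

text \<open>
  The numerator and denominator may depend on the point \<open>a\<close>. The quotient is used only on the
  relatively open set where \<open>G\<close> does not vanish, which is a neighbourhood of \<open>a\<close> in \<open>I\<close>.
\<close>

lemma smooth_on_local_quotient:
  assumes lim: "\<And>x. x \<in> I \<Longrightarrow> x islimpt I"
    and quot: "\<And>a. a \<in> I \<Longrightarrow> \<exists>F G. smooth_on I F \<and> smooth_on I G \<and> G a \<noteq> 0 \<and>
      (\<forall>x\<in>I. G x \<noteq> 0 \<longrightarrow> \<phi> x = F x / G x)"
  shows "smooth_on I \<phi>"
proof (rule smooth_on_locally)
  fix a assume a: "a \<in> I"
  with quot obtain F G where FG: "smooth_on I F" "smooth_on I G" "G a \<noteq> 0"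
    "\<And>x. x \<in> I \<Longrightarrow> G x \<noteq> 0 \<Longrightarrow> \<phi> x = F x / G x" by metis
  obtain U where U: "open U" "U \<inter> I = G -` (- {0}) \<inter> I"
    using smooth_on_imp_continuous_on[OF FG(2)] unfolding continuous_on_open_invariant
    by (metis open_Compl closed_singleton)
  have nz: "x \<in> I \<inter> U \<Longrightarrow> G x \<noteq> 0" for x using U(2) by auto
  have "x islimpt I \<inter> U" if "x \<in> I \<inter> U" for x
    using that lim U(1) by (intro islimpt_Int_eventually) (auto intro: eventually_at_in_open')
  then have "smooth_on (I \<inter> U) (\<lambda>x. F x / G x)"
    using FG nz U(1) by (intro smooth_on_divide smooth_on_Int_open) auto
  moreover have "a \<in> U" using U(2) a FG(3) by auto
  ultimately show "\<exists>U h. open U \<and> a \<in> U \<and> smooth_on (I \<inter> U) h \<and> (\<forall>y\<in>I \<inter> U. \<phi> y = h y)"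
    using U(1) FG(4) nz by (intro exI[of _ U] exI[of _ "\<lambda>x. F x / G x"]) auto
qed

text \<open>At an isolated point every linear map is a derivative of every function.\<close>

lemma smooth_on_singleton: "smooth_on {a} f"
proof -
  have "at a within {a} = bot" by (simp add: at_within_eq_bot_iff)
  then have "(h has_derivative (\<lambda>_. 0)) (at a within {a})" for h :: "real \<Rightarrow> real"
    using has_derivative_bot[OF bounded_linear_zero] by simp
  then show ?thesis by (auto simp: smooth_on_def differentiable_on_def differentiable_def)
qed

theorem theorem1:
  fixes I :: "real set" and f g :: "real \<Rightarrow> real"
  assumes "is_interval I"
    and "smooth_on I f" and "smooth_on I g"
    and "simple_zeros_on I f" and "simple_zeros_on I g"
    and "{a \<in> I. f a = 0} = {a \<in> I. g a = 0}"
  shows "\<exists>\<phi> :: real \<Rightarrow> real.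
      smooth_on I \<phi> \<and>
      (\<forall>x\<in>I. \<phi> x \<noteq> 0) \<and>
      (\<forall>x\<in>I. f x = g x * \<phi> x) \<and>
      (\<forall>a\<in>I. f a = 0 \<and> g a = 0 \<longrightarrow> \<phi> a = deriv_within I f a / deriv_within I g a)"
proof -
  define \<phi> where "\<phi> x = (if g x = 0 then deriv_within I f x / deriv_within I g x else f x / g x)" for x
  have zeros: "f x = 0 \<longleftrightarrow> g x = 0" if "x \<in> I" for x 
    using assms(6) that by (auto simp: set_eq_iff)
  have f': "deriv_within I f x \<noteq> 0" and g': "deriv_within I g x \<noteq> 0" if "x \<in> I" "g x = 0" for x
    using assms(4,5) that zeros unfolding simple_zeros_on_def by blast+
  have "smooth_on I \<phi>"
  proof (cases "\<exists>a. I = {a}")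
    case True
    then show ?thesis using smooth_on_singleton by auto
  next
    case False
    have I: "connected I" "convex I"
      using assms(1) by (simp_all add: is_interval_connected is_interval_convex)
    have lim: "x islimpt I" if "x \<in> I" for x
      using connected_imp_perfect[OF I(1) that] False by blast
    show ?thesis
    proof (rule smooth_on_local_quotient[OF lim])
      fix a assume a: "a \<in> I"
      show "\<exists>F G. smooth_on I F \<and> smooth_on I G \<and> G a \<noteq> 0 \<and>
          (\<forall>x\<in>I. G x \<noteq> 0 \<longrightarrow> \<phi> x = F x / G x)"
      proof (cases "g a = 0")
        case False
        then show ?thesis
          using assms(2,3) by (intro exI[of _ f] exI[of _ g]) (simp add: \<phi>_def)
      next
        case True
        obtain F where F: "smooth_on I F" "F a = deriv_within I f a"
          "\<And>x. x \<in> I \<Longrightarrow> f x = (x - a) * F x"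
          using smooth_on_linear_factor[OF lim I(2) a assms(2)] zeros[OF a] True by auto
        obtain G where G: "smooth_on I G" "G a = deriv_within I g a"
          "\<And>x. x \<in> I \<Longrightarrow> g x = (x - a) * G x"
          using smooth_on_linear_factor[OF lim I(2) a assms(3)] True by auto
        have "\<phi> x = F x / G x" if "x \<in> I" "G x \<noteq> 0" for x
          using that F G by (cases "x = a") (auto simp: \<phi>_def)
        moreover have "G a \<noteq> 0" using G(2) g'[OF a True] by simp
        ultimately show ?thesis using F(1) G(1) by (intro exI[of _ F] exI[of _ G]) simp
      qed
    qed
  qed
  moreover have "\<phi> x \<noteq> 0" "f x = g x * \<phi> x" if "x \<in> I" for x
    using that zeros[OF that] f' g' by (auto simp: \<phi>_def)
  moreover have "\<phi> a = deriv_within I f a / deriv_within I g a" if "g a = 0" for a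
    using that by (simp add: \<phi>_def)
  ultimately show ?thesis by blast
qed

end
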